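(* Let $F=(X,R)$ be a transitive Kripke frame. Then the complex algebra $A(F)$ is locally finite if and only if $F$ is well-founded and $D$-free.
   Context: A Kripke frame $(X,R)$ is a set $X$ with a binary relation $R$; it is transitive if $R$ is. The complex algebra of $F=(X,R)$ is the modal algebra $A(F)=(\mathcal{P}(X),\Diamond_R)$, where $\Diamond_R U=R^{-1}[U]=\{x\in X\mid\exists u\in U\ (xRu)\}$. An algebra is locally finite if each of its finitely generated subalgebras is finite (subalgebras here are closed under the Boolean operations and $\Diamond_R$). A transitive frame $(X,R)$ is well-founded if it contains no infinite descending chain, i.e. there is no sequence $x_0,x_1,x_2,\dots$ in $X$ such that for all $n$, $x_{n+1}Rx_n$ and not $x_nRx_{n+1}$. Let $D=\bigsqcup_{\alpha\in\omega}(\alpha,\leq_\alpha)$ be the disjoint union of all finite ordinals regarded as reflexive linear orders: its elements are the pairs $(\alpha,x)$ with $\alpha\in\omega$ and $x\in\alpha$, and $(\alpha,x)$ is related to $(\beta,y)$ iff $\alpha=\beta$ and $x\leq y$. A transitive frame $(X,R)$ is $D$-free if $D$ is not a substructure of $(X,R\cup\Delta_X)$, where $\Delta_X=\{(x,x)\mid x\in X\}$; that is, no subset $Y\subseteq X$ with the restriction of $R\cup\Delta_X$ to $Y$ is isomorphic to $D$. *)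

theory Defs
  imports Complex_Main
begin

definition kripke_frame :: "'a set \<Rightarrow> 'a rel \<Rightarrow> bool" where
  "kripke_frame X R \<longleftrightarrow> R \<subseteq> X \<times> X"

text \<open>The signature of modal algebras. Join, top and the remaining Boolean operations
  are term-definable from these.\<close>

record 'b modal_algebra =
  ma_carrier :: "'b set"
  ma_bot :: 'b
  ma_meet :: "'b \<Rightarrow> 'b \<Rightarrow> 'b"
  ma_compl :: "'b \<Rightarrow> 'b"
  ma_dia :: "'b \<Rightarrow> 'b"

definition subalgebra :: "'b modal_algebra \<Rightarrow> 'b set \<Rightarrow> bool" where
  "subalgebra A B \<longleftrightarrow>
     B \<subseteq> ma_carrier A \<and>
     ma_bot A \<in> B \<and>
     (\<forall>a\<in>B. \<forall>b\<in>B. ma_meet A a b \<in> B) \<and>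
     (\<forall>a\<in>B. ma_compl A a \<in> B) \<and>
     (\<forall>a\<in>B. ma_dia A a \<in> B)"

definition finitely_generated_subalgebra :: "'b modal_algebra \<Rightarrow> 'b set \<Rightarrow> bool" where
  "finitely_generated_subalgebra A B \<longleftrightarrow>
     (\<exists>G. finite G \<and> G \<subseteq> ma_carrier A \<and> B = subalgebra A hull G)"

definition locally_finite :: "'b modal_algebra \<Rightarrow> bool" where
  "locally_finite A \<longleftrightarrow> (\<forall>B. finitely_generated_subalgebra A B \<longrightarrow> finite B)"

definition complex_algebra :: "'a set \<Rightarrow> 'a rel \<Rightarrow> 'a set modal_algebra" where
  "complex_algebra X R =
     \<lparr>ma_carrier = Pow X, ma_bot = {}, ma_meet = (\<inter>), ma_compl = (\<lambda>U. X - U),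
      ma_dia = (\<lambda>U. {x \<in> X. \<exists>u\<in>U. (x, u) \<in> R})\<rparr>"

text \<open>Distinct from \<^const>\<open>wf\<close>: reflexive points and clusters are allowed, only strictly
  descending chains are excluded.\<close>

definition well_founded_frame :: "'a set \<Rightarrow> 'a rel \<Rightarrow> bool" where
  "well_founded_frame X R \<longleftrightarrow>
     \<not> (\<exists>x :: nat \<Rightarrow> 'a. (\<forall>n. x n \<in> X) \<and>
          (\<forall>n. (x (Suc n), x n) \<in> R \<and> (x n, x (Suc n)) \<notin> R))"

definition frames_isomorphic :: "'a set \<Rightarrow> 'a rel \<Rightarrow> 'b set \<Rightarrow> 'b rel \<Rightarrow> bool" where
  "frames_isomorphic X R Y S \<longleftrightarrow>
     (\<exists>f. bij_betw f X Y \<and> (\<forall>x\<in>X. \<forall>y\<in>X. (x, y) \<in> R \<longleftrightarrow> (f x, f y) \<in> S))"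

text \<open>A finite ordinal \<open>\<alpha>\<close> is the set of natural numbers below \<open>\<alpha>\<close>.\<close>

definition D_carrier :: "(nat \<times> nat) set" where
  "D_carrier = (SIGMA \<alpha>:UNIV. {..<\<alpha>})"

definition D_rel :: "(nat \<times> nat) rel" where
  "D_rel = {((\<alpha>, x), (\<beta>, y)) | \<alpha> x \<beta> y. x < \<alpha> \<and> y < \<beta> \<and> \<alpha> = \<beta> \<and> x \<le> y}"

definition D_free :: "'a set \<Rightarrow> 'a rel \<Rightarrow> bool" where
  "D_free X R \<longleftrightarrow>
     \<not> (\<exists>Y\<subseteq>X. frames_isomorphic D_carrier D_rel Y (Restr (R \<union> Id_on X) Y))"

end

theory Submission
  imports Defs
begin

text \<open>The algebra is locally finite as soon as \<open>X\<close> is tunable, that is, every finite colouring has a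
  finite refinement in which the colour of a point determines the set of colours it sees. The
  tunable sets are closed under subsets and under unions with a relatively upward closed set, and
  contain all sets of finite height. Suppose that \<open>X\<close> is well-founded but not tunable. A minimal
  point with non-tunable down-set yields a non-tunable \<open>Y\<close> in which all principal down-sets are
  tunable. If every non-tunable subset of \<open>Y\<close> contains, for each \<open>n\<close>, a chain of length \<open>n\<close> whose
  set of incomparable points is still non-tunable, then picking such chains one after the other
  produces a copy of \<open>D\<close>. Otherwise, for some subset and some \<open>m\<close>, the points incomparable to any
  given \<open>m\<close>-chain form a tunable set, so every point outside a part of finite height has a cone
  with tunable complement. Then a colour not seen from everywhere disappears on a cone with tunable
  complement, and the set is tunable after all.

  Conversely, in an infinite descending chain and in \<open>D\<close> (measuring depth from the top of each
  component), the points of even depth generate all sets \<open>{depth \<ge> k}\<close>.\<close>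

section \<open>Tuned colourings\<close>

text \<open>Equivalently, identifying points of equal colour is a bounded morphism from
  \<open>Y\<close>, with \<open>R\<close> restricted to it, onto the quotient.\<close>

definition tuned :: "'a rel \<Rightarrow> 'a set \<Rightarrow> ('a \<Rightarrow> 'b) \<Rightarrow> bool" where
  "tuned R Y g \<longleftrightarrow>
     (\<forall>x\<in>Y. \<forall>y\<in>Y. \<forall>z\<in>Y. g x = g y \<longrightarrow> (x, z) \<in> R \<longrightarrow> (\<exists>w\<in>Y. (y, w) \<in> R \<and> g w = g z))"

text \<open>The colours of \<open>g\<close> are numbers because an existential quantifier cannot
  range over types; finitely many colours always embed into \<open>nat\<close>.\<close>

definition has_tuned_refinement :: "'a rel \<Rightarrow> 'a set \<Rightarrow> ('a \<Rightarrow> 'b) \<Rightarrow> bool" where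
  "has_tuned_refinement R Y f \<longleftrightarrow>
     (\<exists>g :: 'a \<Rightarrow> nat. finite (g ` Y) \<and> (\<forall>x\<in>Y. \<forall>y\<in>Y. g x = g y \<longrightarrow> f x = f y) \<and> tuned R Y g)"

definition tunable :: "'a rel \<Rightarrow> 'a set \<Rightarrow> bool" where
  "tunable R Y \<longleftrightarrow> (\<forall>f :: 'a \<Rightarrow> nat. finite (f ` Y) \<longrightarrow> has_tuned_refinement R Y f)"

definition strict_chain :: "'a rel \<Rightarrow> 'a set \<Rightarrow> nat \<Rightarrow> (nat \<Rightarrow> 'a) \<Rightarrow> bool" where
  "strict_chain R Y n c \<longleftrightarrow>
     (\<forall>i<n. c i \<in> Y) \<and> (\<forall>i j. i < j \<longrightarrow> j < n \<longrightarrow> (c i, c j) \<in> R \<and> (c j, c i) \<notin> R)"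

definition incomparable_part :: "'a rel \<Rightarrow> 'a set \<Rightarrow> nat \<Rightarrow> (nat \<Rightarrow> 'a) \<Rightarrow> 'a set" where
  "incomparable_part R Y n c =
     {y \<in> Y. \<forall>i<n. y \<noteq> c i \<and> (y, c i) \<notin> R \<and> (c i, y) \<notin> R}"

text \<open>\<open>U\<close> may reach outside \<open>Y\<close>, so that one cone can be used to
  split many different sets.\<close>

definition closed_up :: "'a rel \<Rightarrow> 'a set \<Rightarrow> 'a set \<Rightarrow> bool" where
  "closed_up R Y U \<longleftrightarrow> (\<forall>x\<in>Y \<inter> U. \<forall>y\<in>Y. (x, y) \<in> R \<longrightarrow> y \<in> U)"

lemma finite_coloring_to_nat:
  fixes h :: "'a \<Rightarrow> 'b"
  assumes "finite (h ` Y)"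
  obtains g :: "'a \<Rightarrow> nat"
  where "finite (g ` Y)" "\<And>x y. x \<in> Y \<Longrightarrow> y \<in> Y \<Longrightarrow> g x = g y \<longleftrightarrow> h x = h y"
proof -
  obtain e :: "'b \<Rightarrow> nat" where e: "inj_on e (h ` Y)"
    using finite_imp_inj_to_nat_seg[OF assms] by auto
  have "finite ((e \<circ> h) ` Y)"
    using assms by (simp only: image_comp[symmetric] finite_imageI)
  moreover have "(e \<circ> h) x = (e \<circ> h) y \<longleftrightarrow> h x = h y" if "x \<in> Y" "y \<in> Y" for x y
    using e that by (auto dest: inj_onD)
  ultimately show thesis using that by blast
qed

lemma has_tuned_refinementI:
  fixes f :: "'a \<Rightarrow> 'b"
  assumes "finite (h ` Y)" "\<And>x y. x \<in> Y \<Longrightarrow> y \<in> Y \<Longrightarrow> h x = h y \<Longrightarrow> f x = f y" "tuned R Y h"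
  shows "has_tuned_refinement R Y f"
proof -
  obtain g :: "'a \<Rightarrow> nat" where fin: "finite (g ` Y)"
    and g: "\<And>x y. x \<in> Y \<Longrightarrow> y \<in> Y \<Longrightarrow> g x = g y \<longleftrightarrow> h x = h y"
    using finite_coloring_to_nat[OF assms(1)] by blast
  have "tuned R Y g"
    unfolding tuned_def
  proof (intro ballI impI)
    fix x y z assume xyz: "x \<in> Y" "y \<in> Y" "z \<in> Y" "g x = g y" "(x, z) \<in> R"
    then have "h x = h y" using g by blast
    then obtain w where "w \<in> Y" "(y, w) \<in> R" "h w = h z"
      using assms(3) xyz unfolding tuned_def by blast
    then show "\<exists>w\<in>Y. (y, w) \<in> R \<and> g w = g z" using g xyz by auto
  qed
  then show ?thesis
    unfolding has_tuned_refinement_def using fin g assms(2) by blast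
qed

lemma has_tuned_refinementE:
  fixes f :: "'a \<Rightarrow> 'b"
  assumes "has_tuned_refinement R Y f"
  obtains g :: "'a \<Rightarrow> nat" where "finite (g ` Y)"
    "\<And>x y. x \<in> Y \<Longrightarrow> y \<in> Y \<Longrightarrow> g x = g y \<Longrightarrow> f x = f y" "tuned R Y g"
  using assms unfolding has_tuned_refinement_def by blast

lemma tunableD:
  fixes f :: "'a \<Rightarrow> 'b"
  assumes "tunable R Y" "finite (f ` Y)"
  shows "has_tuned_refinement R Y f"
proof -
  obtain g :: "'a \<Rightarrow> nat" where fin: "finite (g ` Y)"
    and g: "\<And>x y. x \<in> Y \<Longrightarrow> y \<in> Y \<Longrightarrow> g x = g y \<longleftrightarrow> f x = f y"
    using finite_coloring_to_nat[OF assms(2)] by blast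
  have "has_tuned_refinement R Y g"
    using assms(1) fin unfolding tunable_def by blast
  then obtain h :: "'a \<Rightarrow> nat" where "finite (h ` Y)" "tuned R Y h"
    "\<And>x y. x \<in> Y \<Longrightarrow> y \<in> Y \<Longrightarrow> h x = h y \<Longrightarrow> g x = g y"
    by (rule has_tuned_refinementE) blast
  then show ?thesis
    unfolding has_tuned_refinement_def using g by blast
qed

section \<open>Closure properties of tunable sets\<close>

text \<open>Points of \<open>U\<close> see only points of \<open>U\<close>, so a tuned colouring of
  the upper part can be kept. The lower part is coloured by \<open>f\<close> together with the set
  of upper colours seen, and then tuned. As this colouring is finer than \<open>f\<close>, the lower
  part must be tunable, while the upper part only has to handle \<open>f\<close> itself.\<close>

lemma has_tuned_refinement_Un:
  fixes f :: "'a \<Rightarrow> 'b"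
  assumes Z: "has_tuned_refinement R (Y \<inter> U) f" and W: "tunable R (Y - U)"
    and up: "closed_up R Y U" and fin: "finite (f ` Y)"
  shows "has_tuned_refinement R Y f"
proof -
  obtain g :: "'a \<Rightarrow> nat" where g: "finite (g ` (Y \<inter> U))"
      "\<And>x y. x \<in> Y \<inter> U \<Longrightarrow> y \<in> Y \<inter> U \<Longrightarrow> g x = g y \<Longrightarrow> f x = f y" "tuned R (Y \<inter> U) g"
    by (rule has_tuned_refinementE[OF Z]) blast
  define s where "s x = g ` {y \<in> Y \<inter> U. (x, y) \<in> R}" for x
  have "s ` (Y - U) \<subseteq> Pow (g ` (Y \<inter> U))" by (auto simp: s_def)
  then have "finite (s ` (Y - U))" using g(1) by (meson finite_Pow_iff finite_subset)
  moreover have "finite (f ` (Y - U))" using fin by (rule finite_subset[rotated]) auto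
  ultimately have "finite (f ` (Y - U) \<times> s ` (Y - U))" by blast
  then have "finite ((\<lambda>x. (f x, s x)) ` (Y - U))" by (rule finite_subset[rotated]) auto
  from tunableD[OF W this] obtain h :: "'a \<Rightarrow> nat" where h: "finite (h ` (Y - U))"
      "\<And>x y. x \<in> Y - U \<Longrightarrow> y \<in> Y - U \<Longrightarrow> h x = h y \<Longrightarrow> f x = f y \<and> s x = s y" "tuned R (Y - U) h"
    by (rule has_tuned_refinementE) blast
  define k where "k x = (if x \<in> U then Inl (g x) else Inr (h x) :: nat + nat)" for x
  show ?thesis
  proof (rule has_tuned_refinementI[of k])
    have "k ` Y \<subseteq> Inl ` g ` (Y \<inter> U) \<union> Inr ` h ` (Y - U)" by (auto simp: k_def)
    then show "finite (k ` Y)" using g(1) h(1) by (meson finite_UnI finite_imageI finite_subset)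
  next
    fix x y assume "x \<in> Y" "y \<in> Y" "k x = k y"
    then show "f x = f y"
      using g(2)[of x y] h(2)[of x y] by (auto simp: k_def split: if_splits)
  next
    show "tuned R Y k"
      unfolding tuned_def
    proof (intro ballI impI)
      fix x y z assume xyz: "x \<in> Y" "y \<in> Y" "z \<in> Y" "k x = k y" "(x, z) \<in> R"
      consider "x \<in> U" "z \<in> U" | "x \<notin> U" "z \<in> U" | "x \<notin> U" "z \<notin> U"
        using up xyz unfolding closed_up_def by blast
      then show "\<exists>w\<in>Y. (y, w) \<in> R \<and> k w = k z"
      proof cases
        case 1
        then have "y \<in> U" "g x = g y" using xyz by (auto simp: k_def split: if_splits)
        then obtain w where "w \<in> Y \<inter> U" "(y, w) \<in> R" "g w = g z"
          using g(3) 1 xyz unfolding tuned_def by blast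
        then show ?thesis using 1 by (auto simp: k_def)
      next
        case 2
        then have "y \<notin> U" "h x = h y" using xyz by (auto simp: k_def split: if_splits)
        then have "s x = s y" using h(2) 2 xyz by blast
        moreover have "g z \<in> s x" using 2 xyz by (auto simp: s_def)
        ultimately obtain w where "w \<in> Y \<inter> U" "(y, w) \<in> R" "g w = g z"
          by (auto simp: s_def)
        then show ?thesis using 2 by (auto simp: k_def)
      next
        case 3
        then have "y \<notin> U" "h x = h y" using xyz by (auto simp: k_def split: if_splits)
        then obtain w where "w \<in> Y - U" "(y, w) \<in> R" "h w = h z"
          using h(3) 3 xyz unfolding tuned_def by blast
        then show ?thesis using 3 by (auto simp: k_def)
      qed
    qed
  qed
qed

lemma tunable_Un:
  fixes R :: "'a rel"
  assumes "tunable R (Y \<inter> U)" "tunable R (Y - U)" "closed_up R Y U"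
  shows "tunable R Y"
  unfolding tunable_def
proof (intro allI impI)
  fix f :: "'a \<Rightarrow> nat" assume fin: "finite (f ` Y)"
  then have "finite (f ` (Y \<inter> U))" by (rule finite_subset[rotated]) auto
  then show "has_tuned_refinement R Y f"
    using has_tuned_refinement_Un[OF tunableD[OF assms(1)] assms(2,3) fin] by blast
qed

text \<open>Extend the colouring by the fresh colour 0 outside \<open>Z\<close>. A tuned refinement
  on \<open>Y\<close> then never gives a point of \<open>Z\<close> and a point outside
  \<open>Z\<close> the same colour, so the witnesses it provides for points of \<open>Z\<close> stay
  in \<open>Z\<close>.\<close>

lemma tunable_subset:
  fixes R :: "'a rel"
  assumes "tunable R Y" "Z \<subseteq> Y"
  shows "tunable R Z"
  unfolding tunable_def
proof (intro allI impI)
  fix f :: "'a \<Rightarrow> nat" assume fin: "finite (f ` Z)"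
  define f' where "f' x = (if x \<in> Z then Suc (f x) else 0)" for x
  have "f' ` Y \<subseteq> insert 0 (Suc ` f ` Z)" by (auto simp: f'_def)
  then have "finite (f' ` Y)" using fin by (meson finite.insertI finite_imageI finite_subset)
  from tunableD[OF assms(1) this] obtain g :: "'a \<Rightarrow> nat" where g: "finite (g ` Y)"
      "\<And>x y. x \<in> Y \<Longrightarrow> y \<in> Y \<Longrightarrow> g x = g y \<Longrightarrow> f' x = f' y" "tuned R Y g"
    by (rule has_tuned_refinementE) blast
  show "has_tuned_refinement R Z f"
  proof (rule has_tuned_refinementI[of g])
    show "finite (g ` Z)" using g(1) assms(2) by (meson finite_subset image_mono)
  next
    fix x y assume "x \<in> Z" "y \<in> Z" "g x = g y"
    then show "f x = f y" using g(2)[of x y] assms(2) by (auto simp: f'_def)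
  next
    show "tuned R Z g"
      unfolding tuned_def
    proof (intro ballI impI)
      fix x y z assume xyz: "x \<in> Z" "y \<in> Z" "z \<in> Z" "g x = g y" "(x, z) \<in> R"
      then obtain w where w: "w \<in> Y" "(y, w) \<in> R" "g w = g z"
        using g(3) assms(2) unfolding tuned_def by blast
      then have "f' w = f' z" using g(2) xyz assms(2) by blast
      then have "w \<in> Z" using xyz by (auto simp: f'_def split: if_splits)
      then show "\<exists>w\<in>Z. (y, w) \<in> R \<and> g w = g z" using w by blast
    qed
  qed
qed

text \<open>On \<open>Y\<close> the relation is symmetric and transitive, so related points see the
  same points of \<open>Y\<close>. Hence the set \<open>s x\<close> of colours seen is constant
  along \<open>R\<close>, and adding it to the colour already gives a tuned colouring.\<close>

lemma tunable_clusters: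
  fixes R :: "'a rel"
  assumes "trans R" and sym: "\<And>x y. x \<in> Y \<Longrightarrow> y \<in> Y \<Longrightarrow> (x, y) \<in> R \<Longrightarrow> (y, x) \<in> R"
  shows "tunable R Y"
  unfolding tunable_def
proof (intro allI impI)
  fix f :: "'a \<Rightarrow> nat" assume fin: "finite (f ` Y)"
  define s where "s x = f ` {y \<in> Y. (x, y) \<in> R}" for x
  show "has_tuned_refinement R Y f"
  proof (rule has_tuned_refinementI[of "\<lambda>x. (f x, s x)"])
    have "(\<lambda>x. (f x, s x)) ` Y \<subseteq> f ` Y \<times> Pow (f ` Y)" by (auto simp: s_def)
    then show "finite ((\<lambda>x. (f x, s x)) ` Y)"
      using fin by (meson finite_Pow_iff finite_SigmaI finite_subset)
  next
    have s_eq: "s x = s y" if "x \<in> Y" "y \<in> Y" "(x, y) \<in> R" for x y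
    proof -
      have "{z \<in> Y. (x, z) \<in> R} = {z \<in> Y. (y, z) \<in> R}"
        using that sym[OF that] \<open>trans R\<close> by (auto elim: transE)
      then show ?thesis by (simp add: s_def)
    qed
    show "tuned R Y (\<lambda>x. (f x, s x))"
      unfolding tuned_def
    proof (intro ballI impI)
      fix x y z assume xyz: "x \<in> Y" "y \<in> Y" "z \<in> Y" "(f x, s x) = (f y, s y)" "(x, z) \<in> R"
      then have "f z \<in> s y" by (auto simp: s_def)
      then obtain w where w: "w \<in> Y" "(y, w) \<in> R" "f w = f z" by (auto simp: s_def)
      then have "s w = s z" using s_eq xyz by (metis prod.inject)
      then show "\<exists>w\<in>Y. (y, w) \<in> R \<and> (f w, s w) = (f z, s z)" using w by blast
    qed
  qed auto
qed

section \<open>Strict chains and finite height\<close>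

lemma strict_chain_Cons:
  assumes "trans R" "strict_chain R Y n c" "y \<in> Y"
    and "0 < n \<Longrightarrow> (y, c 0) \<in> R \<and> (c 0, y) \<notin> R"
  shows "strict_chain R Y (Suc n) (case_nat y c)"
  unfolding strict_chain_def
proof (intro conjI allI impI)
  fix i assume "i < Suc n"
  then show "case_nat y c i \<in> Y" using assms by (auto simp: strict_chain_def split: nat.splits)
next
  have c: "(c i, c j) \<in> R \<and> (c j, c i) \<notin> R" if "i < j" "j < n" for i j
    using assms that by (auto simp: strict_chain_def)
  have y: "(y, c j) \<in> R \<and> (c j, y) \<notin> R" if "j < n" for j
  proof (cases j)
    case (Suc k)
    then have "(c 0, c j) \<in> R" using that c by auto
    moreover have "(y, c 0) \<in> R" "(c 0, y) \<notin> R" using assms(4) that by auto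
    ultimately show ?thesis using assms(1) by (auto dest: transD)
  qed (use assms that in auto)
  fix i j :: nat assume ij: "i < j" "j < Suc n"
  obtain j' where j': "j = Suc j'" using ij by (cases j) auto
  show "(case_nat y c i, case_nat y c j) \<in> R" and "(case_nat y c j, case_nat y c i) \<notin> R"
    using c y ij j' by (auto split: nat.splits)
qed

lemma strict_chain_mono: "strict_chain R Y n c \<Longrightarrow> Y \<subseteq> Z \<Longrightarrow> strict_chain R Z n c"
  by (auto simp: strict_chain_def)

text \<open>Induction on the height, peeling off the bottom layer: \<open>Y - U\<close> consists of
  the points without strict predecessor in \<open>Y\<close>, on which \<open>R\<close> is symmetric,
  and a chain in \<open>Y \<inter> U\<close> can be prolonged downwards inside
  \<open>Y\<close>.\<close>

lemma tunable_finite_height: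
  assumes "trans R" "\<And>c. \<not> strict_chain R Y n c"
  shows "tunable R Y"
  using assms(2)
proof (induction n arbitrary: Y)
  case 0
  then show ?case by (auto simp: strict_chain_def)
next
  case (Suc n)
  define U where "U = {y. \<exists>w\<in>Y. (w, y) \<in> R \<and> (y, w) \<notin> R}"
  show ?case
  proof (rule tunable_Un[of _ _ U])
    show "tunable R (Y - U)" by (rule tunable_clusters[OF assms(1)]) (auto simp: U_def)
    show "closed_up R Y U"
      unfolding closed_up_def U_def using assms(1) by (blast dest: transD)
    show "tunable R (Y \<inter> U)"
    proof (cases "Y \<inter> U = {}")
      case True
      then show ?thesis by (auto intro: tunable_clusters[OF assms(1)])
    next
      case False
      have "\<not> strict_chain R (Y \<inter> U) n c" for c
      proof
        assume c: "strict_chain R (Y \<inter> U) n c"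
        \<comment> \<open>For \<open>n = 0\<close> there is no first point to go below; any point of
          \<open>Y\<close> then forms a chain of length 1, which is why \<open>Y \<inter> U\<close>
          had to be nonempty.\<close>
        obtain w where "w \<in> Y" "0 < n \<Longrightarrow> (w, c 0) \<in> R \<and> (c 0, w) \<notin> R"
        proof (cases "n = 0")
          case True
          then show ?thesis using that False by blast
        next
          case False
          then have "c 0 \<in> U" using c by (auto simp: strict_chain_def)
          then show ?thesis using that by (auto simp: U_def)
        qed
        then show False
          using strict_chain_Cons[OF assms(1) strict_chain_mono[OF c]] Suc.prems by blast
      qed
      then show ?thesis by (rule Suc.IH)
    qed
  qed
qed

section \<open>Cones and incomparable parts\<close>

text \<open>After removing finitely many cone complements, every remaining colour is seen from every
  remaining point, so on this up-set the colouring itself is tuned.\<close>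

lemma tunable_if_cone_complements_tunable:
  fixes R :: "'a rel"
  assumes "trans R" and Z: "\<And>y. y \<in> Z \<Longrightarrow> tunable R {w \<in> Z. w \<noteq> y \<and> (y, w) \<notin> R}"
  shows "tunable R Z"
  unfolding tunable_def
proof (intro allI impI)
  fix f :: "'a \<Rightarrow> nat" assume fin: "finite (f ` Z)"
  define cone where "cone y = {w. w = y \<or> (y, w) \<in> R}" for y
  \<comment> \<open>\<open>K\<close> collects the colours that some point fails to see; the
    \<open>p k\<close> are such points, and \<open>H\<close> below is the intersection of their
    cones.\<close>
  define K where "K = {k \<in> f ` Z. \<exists>y\<in>Z. \<forall>w\<in>Z. (y, w) \<in> R \<longrightarrow> f w \<noteq> k}"
  have "\<forall>k\<in>K. \<exists>y\<in>Z. \<forall>w\<in>Z. (y, w) \<in> R \<longrightarrow> f w \<noteq> k" by (auto simp: K_def)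
  then obtain p where p: "\<And>k. k \<in> K \<Longrightarrow> p k \<in> Z"
    "\<And>k w. k \<in> K \<Longrightarrow> w \<in> Z \<Longrightarrow> (p k, w) \<in> R \<Longrightarrow> f w \<noteq> k"
    by metis
  have cone_up: "closed_up R V (cone y)" for V y
    using \<open>trans R\<close> by (auto simp: closed_up_def cone_def dest: transD)
  have "tunable R (Z - (\<Inter>k\<in>L. cone (p k)))" if "finite L" "L \<subseteq> K" for L
    using that
  proof (induction L rule: finite_induct)
    case empty
    show ?case by (rule tunable_clusters[OF \<open>trans R\<close>]) auto
  next
    \<comment> \<open>Split along the new cone: inside it only the old cones can be missed, outside
      it the hypothesis on cone complements applies.\<close>
    case (insert k L)
    let ?V = "Z - (\<Inter>k\<in>insert k L. cone (p k))"
    show ?case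
    proof (rule tunable_Un[of _ _ "cone (p k)"])
      show "tunable R (?V \<inter> cone (p k))"
        by (rule tunable_subset[of _ "Z - (\<Inter>k\<in>L. cone (p k))"]) (use insert in auto)
      have "p k \<in> Z" using p(1) insert by auto
      then show "tunable R (?V - cone (p k))"
        by (rule tunable_subset[OF Z]) (auto simp: cone_def)
    qed (rule cone_up)
  qed
  moreover have "finite K" using fin by (auto simp: K_def)
  ultimately have G: "tunable R (Z - (\<Inter>k\<in>K. cone (p k)))" by blast
  define H where "H = (\<Inter>k\<in>K. cone (p k))"
  have up: "closed_up R Z H"
    using cone_up[of Z] unfolding closed_up_def H_def by fast
  have "tuned R (Z \<inter> H) f"
    unfolding tuned_def
  proof (intro ballI impI)
    fix x y z assume xyz: "x \<in> Z \<inter> H" "y \<in> Z \<inter> H" "z \<in> Z \<inter> H" "(x, z) \<in> R"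
    \<comment> \<open>A point of \<open>H\<close> may have a colour in \<open>K\<close>, as
      \<open>p k\<close> itself can, but a point seen from a point of \<open>H\<close> cannot: it is
      a proper successor of every \<open>p k\<close>.\<close>
    have "f z \<notin> K"
    proof
      assume k: "f z \<in> K"
      then have "x \<in> cone (p (f z))" using xyz by (auto simp: H_def)
      then have "(p (f z), z) \<in> R" using xyz \<open>trans R\<close> by (auto simp: cone_def dest: transD)
      then show False using p(2) k xyz by blast
    qed
    then obtain w where "w \<in> Z" "(y, w) \<in> R" "f w = f z" using xyz by (auto simp: K_def)
    then show "\<exists>w\<in>Z \<inter> H. (y, w) \<in> R \<and> f w = f z" using up xyz by (auto simp: closed_up_def)
  qed
  then have "has_tuned_refinement R (Z \<inter> H) f"
    by (rule has_tuned_refinementI[rotated 2]) (use fin in \<open>auto intro: finite_subset[rotated]\<close>)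
  then show "has_tuned_refinement R Z f"
    using has_tuned_refinement_Un G up fin unfolding H_def by blast
qed

text \<open>The points that start no chain of length \<open>Suc m\<close> form an upper part
  \<open>L\<close> of finite height. Each remaining \<open>y\<close> is the bottom of such a chain,
  and a point outside its cone is either below the top of the chain or incomparable to the whole
  chain. So cone complements in \<open>Y - L\<close> are tunable.\<close>

lemma tunable_if_incomparable_parts_tunable:
  assumes "trans R"
    and below: "\<And>y. y \<in> Y \<Longrightarrow> tunable R {z \<in> Y. z = y \<or> (z, y) \<in> R}"
    and inc: "\<And>c. strict_chain R Y (Suc m) c \<Longrightarrow> tunable R (incomparable_part R Y (Suc m) c)"
  shows "tunable R Y"
proof -
  define L where "L = {y. \<forall>c. strict_chain R Y (Suc m) c \<longrightarrow> c 0 \<noteq> y}"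
  have "tunable R (Y \<inter> L)"
  proof (rule tunable_finite_height[OF \<open>trans R\<close>])
    show "\<not> strict_chain R (Y \<inter> L) (Suc m) c" for c
    proof
      assume c: "strict_chain R (Y \<inter> L) (Suc m) c"
      then have "strict_chain R Y (Suc m) c" by (rule strict_chain_mono) auto
      moreover have "c 0 \<in> L" using c by (auto simp: strict_chain_def)
      ultimately show False by (auto simp: L_def)
    qed
  qed
  moreover have "closed_up R Y L"
    unfolding closed_up_def
  proof (intro ballI impI)
    fix x y assume x: "x \<in> Y \<inter> L" and y: "y \<in> Y" "(x, y) \<in> R"
    show "y \<in> L"
      unfolding L_def
    proof (intro CollectI allI impI notI)
      fix c assume c: "strict_chain R Y (Suc m) c" "c 0 = y"
      \<comment> \<open>\<open>x\<close> may lie in the cluster of \<open>y\<close>, so it replaces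
        the first point of the chain instead of being prepended.\<close>
      have "strict_chain R Y (Suc m) (c(0 := x))"
        unfolding strict_chain_def
      proof (intro conjI allI impI)
        fix i assume "i < Suc m"
        then show "(c(0 := x)) i \<in> Y" using c x by (auto simp: strict_chain_def)
      next
        fix i j assume ij: "i < j" "j < Suc m"
        then have *: "(c i, c j) \<in> R" "(c j, c i) \<notin> R" using c by (auto simp: strict_chain_def)
        then show "((c(0 := x)) i, (c(0 := x)) j) \<in> R" "((c(0 := x)) j, (c(0 := x)) i) \<notin> R"
          using ij c(2) y(2) \<open>trans R\<close> by (auto dest: transD)
      qed
      then show False using x by (auto simp: L_def)
    qed
  qed
  moreover have "tunable R (Y - L)"
  proof (rule tunable_if_cone_complements_tunable[OF \<open>trans R\<close>])
    fix y assume "y \<in> Y - L"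
    then obtain c where c: "strict_chain R Y (Suc m) c" "c 0 = y" by (auto simp: L_def)
    let ?W = "{w \<in> Y - L. w \<noteq> y \<and> (y, w) \<notin> R}"
    define V where "V = {w. \<not> (w = c m \<or> (w, c m) \<in> R)}"
    show "tunable R ?W"
    proof (rule tunable_Un[of _ _ V])
      have "c m \<in> Y" using c by (auto simp: strict_chain_def)
      then show "tunable R (?W - V)"
        by (rule tunable_subset[OF below]) (auto simp: V_def)
      show "closed_up R ?W V"
        using \<open>trans R\<close> by (auto simp: closed_up_def V_def dest: transD)
      \<comment> \<open>A point equal or related to some \<open>c i\<close> would lie in the cone of
        the bottom \<open>y\<close> or below the top \<open>c m\<close>.\<close>
      have "?W \<inter> V \<subseteq> incomparable_part R Y (Suc m) c"
      proof
        fix w assume w: "w \<in> ?W \<inter> V"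
        have "w \<noteq> c i \<and> (w, c i) \<notin> R \<and> (c i, w) \<notin> R" if "i < Suc m" for i
        proof -
          have 0: "c i = y \<or> (y, c i) \<in> R"
            using c that by (cases i) (auto simp: strict_chain_def)
          have 1: "c i = c m \<or> (c i, c m) \<in> R"
            using c that by (cases "i = m") (auto simp: strict_chain_def)
          show ?thesis using 0 1 w \<open>trans R\<close> by (auto simp: V_def dest: transD)
        qed
        then show "w \<in> incomparable_part R Y (Suc m) c"
          using w by (auto simp: incomparable_part_def)
      qed
      then show "tunable R (?W \<inter> V)" using tunable_subset[OF inc[OF c(1)]] by blast
    qed
  qed
  ultimately show ?thesis using tunable_Un by blast
qed

section \<open>Constructing a copy of \<open>D\<close>\<close>

text \<open>The hypothesis on down-sets passes to subsets, so by the previous lemma every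
  non-tunable subset of \<open>Y\<close> contains chains of each length with non-tunable
  incomparable part. The choice can therefore be iterated within these parts.\<close>

lemma D_embedding_if_not_tunable:
  assumes "trans R" "\<not> tunable R Y"
    and below: "\<And>y. y \<in> Y \<Longrightarrow> tunable R {z \<in> Y. z = y \<or> (z, y) \<in> R}"
  shows "\<exists>c. (\<forall>n. strict_chain R Y n (c n)) \<and>
    (\<forall>n m i j. n < m \<longrightarrow> i < n \<longrightarrow> j < m \<longrightarrow>
       c n i \<noteq> c m j \<and> (c n i, c m j) \<notin> R \<and> (c m j, c n i) \<notin> R)"
proof -
  have step: "\<exists>c. strict_chain R V n c \<and> \<not> tunable R (incomparable_part R V n c)"
    if V: "V \<subseteq> Y" "\<not> tunable R V" for V n
  proof (cases n)
    case 0
    then show ?thesis using V by (auto simp: strict_chain_def incomparable_part_def)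
  next
    case (Suc m)
    have "tunable R {z \<in> V. z = y \<or> (z, y) \<in> R}" if "y \<in> V" for y
      by (rule tunable_subset[OF below[of y]]) (use V that in auto)
    then show ?thesis
      using tunable_if_incomparable_parts_tunable[OF \<open>trans R\<close>, of V m] V(2) Suc by blast
  qed
  define ch where
    "ch V n = (SOME c. strict_chain R V n c \<and> \<not> tunable R (incomparable_part R V n c))" for V n
  \<comment> \<open>\<open>V (Suc n)\<close> keeps only points incomparable to the chain chosen in
    \<open>V n\<close>; as the sets decrease, every later chain is incomparable to all earlier
    ones.\<close>
  define V where "V = rec_nat Y (\<lambda>n V. incomparable_part R V n (ch V n))"
  have V0: "V 0 = Y" and VS: "V (Suc n) = incomparable_part R (V n) n (ch (V n) n)" for n
    by (simp_all add: V_def)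
  have ch: "strict_chain R W n (ch W n) \<and> \<not> tunable R (incomparable_part R W n (ch W n))"
    if "W \<subseteq> Y" "\<not> tunable R W" for W n
    unfolding ch_def using step[OF that] by (rule someI_ex)
  have V: "V n \<subseteq> Y \<and> \<not> tunable R (V n)" for n
  proof (induction n)
    case (Suc n)
    then show ?case using ch[of "V n" n] by (auto simp: VS incomparable_part_def)
  qed (use assms(2) in \<open>simp add: V0\<close>)
  have anti: "V m \<subseteq> V n" if "n \<le> m" for m n
    using that by (rule lift_Suc_antimono_le[rotated]) (auto simp: VS incomparable_part_def)
  define c where "c n = ch (V n) n" for n
  have c: "strict_chain R (V n) n (c n)" for n
    using ch V by (auto simp: c_def)
  have "c n i \<noteq> c m j \<and> (c n i, c m j) \<notin> R \<and> (c m j, c n i) \<notin> R"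
    if "n < m" "i < n" "j < m" for n m i j
  proof -
    have "c m j \<in> V m" using c[of m] that by (auto simp: strict_chain_def)
    then have "c m j \<in> V (Suc n)" using anti[of "Suc n" m] that by auto
    then show ?thesis using that by (auto simp: VS incomparable_part_def c_def)
  qed
  moreover have "strict_chain R Y n (c n)" for n
    using c V strict_chain_mono by blast
  ultimately show ?thesis by blast
qed

lemma D_carrierE:
  assumes "p \<in> D_carrier"
  obtains n i where "p = (n, i)" "i < n"
  using assms that[of "fst p" "snd p"] by (auto simp: D_carrier_def)

lemma tunable_if_well_founded_D_free:
  assumes "trans R" and wf: "well_founded_frame X R" and D: "D_free X R"
  shows "tunable R X"
proof (rule ccontr)
  assume bad: "\<not> tunable R X"
  have "\<exists>Y\<subseteq>X. \<not> tunable R Y \<and> (\<forall>y\<in>Y. tunable R {z \<in> Y. z = y \<or> (z, y) \<in> R})"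
  proof (cases "\<exists>x\<in>X. \<not> tunable R {z \<in> X. z = x \<or> (z, x) \<in> R}")
    case False
    then show ?thesis using bad by blast
  next
    case True
    define B where "B = {x \<in> X. \<not> tunable R {z \<in> X. z = x \<or> (z, x) \<in> R}}"
    \<comment> \<open>\<open>S\<close> is the strict part of \<open>R\<close> on \<open>X\<close>;
      absence of infinite descending chains makes it well-founded in the sense of \<open>wf\<close>,
      so a minimal bad point exists.\<close>
    define S where "S = {(z, x). z \<in> X \<and> x \<in> X \<and> (z, x) \<in> R \<and> (x, z) \<notin> R}"
    have "wf S"
      using wf unfolding wf_iff_no_infinite_down_chain well_founded_frame_def S_def by blast
    moreover have "B \<noteq> {}" using True by (auto simp: B_def)
    ultimately obtain x where x: "x \<in> B" "\<And>z. (z, x) \<in> S \<Longrightarrow> z \<notin> B"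
      using wfE_min' by metis
    \<comment> \<open>Within the down-set of \<open>x\<close>, the cone \<open>C\<close> is the
      cluster of \<open>x\<close>, which is tunable. Removing it leaves only points strictly below
      \<open>x\<close>, to which minimality of \<open>x\<close> applies.\<close>
    define C where "C = {z. z = x \<or> (x, z) \<in> R}"
    define Y where "Y = {z \<in> X. z = x \<or> (z, x) \<in> R} - C"
    have "closed_up R {z \<in> X. z = x \<or> (z, x) \<in> R} C"
      using \<open>trans R\<close> by (auto simp: closed_up_def C_def dest: transD)
    moreover have "tunable R ({z \<in> X. z = x \<or> (z, x) \<in> R} \<inter> C)"
      by (rule tunable_clusters[OF \<open>trans R\<close>]) (use \<open>trans R\<close> in \<open>auto simp: C_def dest: transD\<close>)
    ultimately have "\<not> tunable R Y" using x(1) tunable_Un unfolding B_def Y_def by blast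
    moreover have "tunable R {z \<in> Y. z = y \<or> (z, y) \<in> R}" if "y \<in> Y" for y
    proof -
      have "(y, x) \<in> S" using that x(1) by (auto simp: Y_def C_def S_def B_def)
      then have "tunable R {z \<in> X. z = y \<or> (z, y) \<in> R}" using x(2) that by (auto simp: B_def Y_def)
      then show ?thesis by (rule tunable_subset) (auto simp: Y_def)
    qed
    ultimately show ?thesis by (intro exI[of _ Y]) (auto simp: Y_def)
  qed
  then obtain Y where Y: "Y \<subseteq> X" "\<not> tunable R Y"
    "\<And>y. y \<in> Y \<Longrightarrow> tunable R {z \<in> Y. z = y \<or> (z, y) \<in> R}" by blast
  then obtain c where c: "\<And>n. strict_chain R Y n (c n)"
    and inc: "\<And>n m i j. n < m \<Longrightarrow> i < n \<Longrightarrow> j < m \<Longrightarrow>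
       c n i \<noteq> c m j \<and> (c n i, c m j) \<notin> R \<and> (c m j, c n i) \<notin> R"
    using D_embedding_if_not_tunable[OF \<open>trans R\<close> Y(2,3)] by blast
  define e where "e = (\<lambda>(n, i). c n i)"
  have inX: "e p \<in> X" if "p \<in> D_carrier" for p
    using c Y(1) that by (auto simp: D_carrier_def e_def strict_chain_def)
  have rel: "(p, q) \<in> D_rel \<longleftrightarrow> (e p, e q) \<in> R \<union> Id_on X" and inj: "e p = e q \<Longrightarrow> p = q"
    if "p \<in> D_carrier" "q \<in> D_carrier" for p q
  proof -
    from that(1) obtain n i where p: "p = (n, i)" "i < n" by (rule D_carrierE)
    from that(2) obtain m j where q: "q = (m, j)" "j < m" by (rule D_carrierE)
    note pq = p(1) q(1) p(2) q(2)
    have chain: "(c n i, c n j) \<in> R \<and> (c n j, c n i) \<notin> R" if "i < j" "j < n" for i j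
      using c[of n] that by (auto simp: strict_chain_def)
    have *: "((p, q) \<in> D_rel \<longleftrightarrow> (e p, e q) \<in> R \<union> Id_on X) \<and> (e p = e q \<longrightarrow> p = q)"
    proof (cases "n = m")
      case False
      then have "c n i \<noteq> c m j \<and> (c n i, c m j) \<notin> R"
        using inc[of n m i j] inc[of m n j i] pq by (metis nat_neq_iff)
      then show ?thesis using pq False by (auto simp: D_rel_def e_def)
    next
      case True
      consider "i < j" | "i = j" | "j < i" by linarith
      then show ?thesis
      proof cases
        case 1
        then show ?thesis using chain[of i j] pq True by (auto simp: D_rel_def e_def)
      next
        case 2
        then show ?thesis using inX[OF that(1)] pq True by (auto simp: D_rel_def e_def Id_on_def)
      next
        case 3
        then show ?thesis using chain[of j i] pq True by (auto simp: D_rel_def e_def)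
      qed
    qed
    then show "(p, q) \<in> D_rel \<longleftrightarrow> (e p, e q) \<in> R \<union> Id_on X" "e p = e q \<Longrightarrow> p = q" by auto
  qed
  have "bij_betw e D_carrier (e ` D_carrier)"
    using inj by (auto simp: bij_betw_def inj_on_def)
  moreover have "(p, q) \<in> D_rel \<longleftrightarrow> (e p, e q) \<in> Restr (R \<union> Id_on X) (e ` D_carrier)"
    if "p \<in> D_carrier" "q \<in> D_carrier" for p q
    using rel[OF that] that by simp
  ultimately have "frames_isomorphic D_carrier D_rel (e ` D_carrier)
      (Restr (R \<union> Id_on X) (e ` D_carrier))"
    unfolding frames_isomorphic_def by (intro exI[of _ e] conjI ballI)
  moreover have "e ` D_carrier \<subseteq> X" using inX by auto
  ultimately show False using D unfolding D_free_def by blast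
qed

section \<open>Finite subalgebras from tuned colourings\<close>

text \<open>Colour each point by the generators containing it. For a tuned refinement
  \<open>g\<close>, the unions of colour classes form a subalgebra: closure under the diamond is
  exactly tunedness. It contains \<open>G\<close> and is finite, as each member is determined by its
  set of colours.\<close>

lemma locally_finite_if_tunable:
  fixes R :: "'a rel"
  assumes "tunable R X"
  shows "locally_finite (complex_algebra X R)"
  unfolding locally_finite_def finitely_generated_subalgebra_def
proof (intro allI impI, elim exE conjE)
  fix B G assume G: "finite G" "G \<subseteq> ma_carrier (complex_algebra X R)"
    and B: "B = subalgebra (complex_algebra X R) hull G"
  define a where "a x = {U \<in> G. x \<in> U}" for x
  have "a ` X \<subseteq> Pow G" by (auto simp: a_def)
  then have "finite (a ` X)" using G(1) by (meson finite_Pow_iff finite_subset)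
  from tunableD[OF assms this] obtain g :: "'a \<Rightarrow> nat" where g: "finite (g ` X)"
    "\<And>x y. x \<in> X \<Longrightarrow> y \<in> X \<Longrightarrow> g x = g y \<Longrightarrow> a x = a y" "tuned R X g"
    by (rule has_tuned_refinementE) blast
  define A where "A = {U. U \<subseteq> X \<and> (\<forall>x\<in>X. \<forall>y\<in>X. g x = g y \<longrightarrow> x \<in> U \<longrightarrow> y \<in> U)}"
  have "subalgebra (complex_algebra X R) A"
  proof -
    have "X - U \<in> A" if "U \<in> A" for U
      unfolding A_def
    proof (intro CollectI conjI ballI impI)
      fix x y assume "x \<in> X" "y \<in> X" "g x = g y" "x \<in> X - U"
      moreover from this have "g y = g x" by simp
      ultimately show "y \<in> X - U" using that unfolding A_def by blast
    qed auto
    moreover have "{x \<in> X. \<exists>u\<in>U. (x, u) \<in> R} \<in> A" if "U \<in> A" for U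
      unfolding A_def
    proof (intro CollectI conjI ballI impI)
      fix x y assume xy: "x \<in> X" "y \<in> X" "g x = g y" "x \<in> {x \<in> X. \<exists>u\<in>U. (x, u) \<in> R}"
      then obtain u where u: "u \<in> U" "u \<in> X" "(x, u) \<in> R" using \<open>U \<in> A\<close> unfolding A_def by blast
      have "\<forall>z\<in>X. g x = g y \<longrightarrow> (x, z) \<in> R \<longrightarrow> (\<exists>w\<in>X. (y, w) \<in> R \<and> g w = g z)"
        using g(3) xy(1,2) unfolding tuned_def by blast
      then obtain w where w: "w \<in> X" "(y, w) \<in> R" "g w = g u"
        using xy(3) u by blast
      have "w \<in> U" using u(1,2) w(1) w(3)[symmetric] \<open>U \<in> A\<close> unfolding A_def by blast
      then show "y \<in> X" "\<exists>u\<in>U. (y, u) \<in> R" using w(2) xy(2) by blast+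
    qed auto
    moreover have "U \<inter> V \<in> A" if "U \<in> A" "V \<in> A" for U V
      using that unfolding A_def by blast
    moreover have "A \<subseteq> Pow X" "{} \<in> A" unfolding A_def by blast+
    ultimately show ?thesis
      by (simp add: subalgebra_def complex_algebra_def)
  qed
  moreover have "G \<subseteq> A"
  proof
    fix U assume "U \<in> G"
    then have "U \<subseteq> X" using G(2) by (auto simp: complex_algebra_def)
    moreover have "y \<in> U" if "x \<in> X" "y \<in> X" "g x = g y" "x \<in> U" for x y
      using g(2)[OF that(1-3)] \<open>U \<in> G\<close> that(4) unfolding a_def by blast
    ultimately show "U \<in> A" unfolding A_def by blast
  qed
  ultimately have "B \<subseteq> A" unfolding B by (intro hull_minimal)
  moreover have "finite A"
  proof (rule finite_subset)
    show "A \<subseteq> (\<lambda>K. {x \<in> X. g x \<in> K}) ` Pow (g ` X)"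
    proof
      fix U assume U: "U \<in> A"
      have "U = {x \<in> X. g x \<in> g ` U}"
      proof (intro equalityI subsetI)
        fix x assume "x \<in> {x \<in> X. g x \<in> g ` U}"
        then obtain u where "x \<in> X" "u \<in> U" "g u = g x" by fastforce
        then show "x \<in> U" using U unfolding A_def by blast
      qed (use U in \<open>unfold A_def, blast\<close>)
      moreover have "g ` U \<subseteq> g ` X" using U unfolding A_def by blast
      ultimately show "U \<in> (\<lambda>K. {x \<in> X. g x \<in> K}) ` Pow (g ` X)" by blast
    qed
  qed (use g(1) in simp)
  ultimately show "finite B" by (rule finite_subset)
qed

section \<open>Unbounded depth and the converse direction\<close>

text \<open>This isolates what descending chains and \<open>D\<close> have in common: a depth
  function that never increases along \<open>R\<close>, with all smaller depths visible. The sets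
  \<open>L k\<close> are obtained one from the other, and are pairwise distinct because every depth
  occurs.\<close>

lemma not_locally_finite_if_unbounded_depth:
  fixes d :: "'a \<Rightarrow> nat"
  assumes "Y \<subseteq> X"
    and mono: "\<And>x y. x \<in> Y \<Longrightarrow> y \<in> Y \<Longrightarrow> (x, y) \<in> R \<Longrightarrow> d y \<le> d x"
    and sees: "\<And>x k. x \<in> Y \<Longrightarrow> k < d x \<Longrightarrow> \<exists>y\<in>Y. (x, y) \<in> R \<and> d y = k"
    and surj: "\<And>k. \<exists>y\<in>Y. d y = k"
  shows "\<not> locally_finite (complex_algebra X R)"
proof
  assume "locally_finite (complex_algebra X R)"
  define E where "E = {y \<in> Y. even (d y)}"
  define B where "B = subalgebra (complex_algebra X R) hull {Y, E}"
  have "{Y, E} \<subseteq> ma_carrier (complex_algebra X R)"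
    using assms(1) by (auto simp: E_def complex_algebra_def)
  then have "finitely_generated_subalgebra (complex_algebra X R) B"
    unfolding finitely_generated_subalgebra_def B_def by (intro exI[of _ "{Y, E}"]) simp
  then have "finite B"
    using \<open>locally_finite _\<close> unfolding locally_finite_def by blast
  have meet: "U \<inter> V \<in> B" if "U \<in> B" "V \<in> B" for U V
    using that by (auto simp: B_def hull_def subalgebra_def complex_algebra_def)
  have compl: "X - U \<in> B" if "U \<in> B" for U
    using that by (auto simp: B_def hull_def subalgebra_def complex_algebra_def)
  have dia: "{x \<in> X. \<exists>u\<in>U. (x, u) \<in> R} \<in> B" if "U \<in> B" for U
    using that by (auto simp: B_def hull_def subalgebra_def complex_algebra_def)
  have join: "U \<union> V \<in> B" if "U \<in> B" "V \<in> B" "U \<subseteq> X" "V \<subseteq> X" for U V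
  proof -
    have "U \<union> V = X - ((X - U) \<inter> (X - V))" using that by auto
    then show ?thesis using meet compl that by simp
  qed
  have gen: "Y \<in> B" "E \<in> B" using hull_subset[of "{Y, E}"] by (auto simp: B_def)
  define L where "L k = {y \<in> Y. k \<le> d y}" for k
  have "L k \<in> B" for k
  proof (induction k)
    case 0
    then show ?case using gen by (simp add: L_def)
  next
    case (Suc k)
    \<comment> \<open>Requiring the parity opposite to that of \<open>k\<close> removes depth
      \<open>k\<close> from \<open>L k\<close>, so the least depth in \<open>W\<close> is
      \<open>Suc k\<close>.\<close>
    define W where "W = L k \<inter> (if even k then X - E else E)"
    have "W \<in> B" using Suc gen meet compl by (simp add: W_def)
    have W: "W = {y \<in> Y. k \<le> d y \<and> even (d y) \<noteq> even k}"
      using assms(1) by (auto simp: W_def L_def E_def)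
    \<comment> \<open>\<open>W\<close> is joined to its diamond because points of depth exactly
      \<open>Suc k\<close> need not see \<open>W\<close>; the meet with the generator
      \<open>Y\<close> discards points outside \<open>Y\<close> that see \<open>W\<close>.\<close>
    have "L (Suc k) = Y \<inter> (W \<union> {x \<in> X. \<exists>u\<in>W. (x, u) \<in> R})"
    proof (intro equalityI subsetI)
      fix y assume y: "y \<in> L (Suc k)"
      then have yY: "y \<in> Y" "y \<in> X" "Suc k \<le> d y" using assms(1) by (auto simp: L_def)
      show "y \<in> Y \<inter> (W \<union> {x \<in> X. \<exists>u\<in>W. (x, u) \<in> R})"
      proof (cases "d y = Suc k")
        case True
        then show ?thesis using yY by (auto simp: W)
      next
        case False
        then obtain z where "z \<in> Y" "(y, z) \<in> R" "d z = Suc k"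
          using sees[of y "Suc k"] yY by auto
        then have "z \<in> W" "(y, z) \<in> R" by (auto simp: W)
        then show ?thesis using yY by blast
      qed
    next
      fix y assume y: "y \<in> Y \<inter> (W \<union> {x \<in> X. \<exists>u\<in>W. (x, u) \<in> R})"
      have W_le: "Suc k \<le> d u" if "u \<in> W" for u
      proof -
        have "k \<noteq> d u" "k \<le> d u" using that by (auto simp: W)
        then show ?thesis by simp
      qed
      have "Suc k \<le> d y"
      proof (cases "y \<in> W")
        case False
        then obtain u where u: "u \<in> W" "(y, u) \<in> R" using y by auto
        then have "d u \<le> d y" using mono y by (auto simp: W)
        then show ?thesis using W_le[OF u(1)] by simp
      qed (rule W_le)
      then show "y \<in> L (Suc k)" using y by (auto simp: L_def)
    qed
    moreover have "W \<subseteq> X" using assms(1) by (auto simp: W)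
    ultimately show ?case using \<open>W \<in> B\<close> meet join dia gen by simp
  qed
  then have "range L \<subseteq> B" by auto
  moreover have "inj L"
  proof (rule linorder_injI)
    fix i j :: nat assume "i < j"
    moreover obtain y where "y \<in> Y" "d y = i" using surj by blast
    ultimately have "y \<in> L i" "y \<notin> L j" by (auto simp: L_def)
    then show "L i \<noteq> L j" by blast
  qed
  ultimately show False
    using \<open>finite B\<close> by (meson finite_imageD finite_subset infinite_UNIV_nat)
qed

text \<open>The depth of \<open>x n\<close> is its index \<open>n\<close>: by transitivity it sees
  exactly all earlier points and possibly itself, never a later one.\<close>

lemma well_founded_if_locally_finite:
  fixes R :: "'a rel"
  assumes "trans R" and lf: "locally_finite (complex_algebra X R)"
  shows "well_founded_frame X R"
  unfolding well_founded_frame_def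
proof (intro notI, elim exE conjE)
  fix x :: "nat \<Rightarrow> 'a"
  assume X: "\<forall>n. x n \<in> X" and x: "\<forall>n. (x (Suc n), x n) \<in> R \<and> (x n, x (Suc n)) \<notin> R"
  have desc: "(x n, x m) \<in> R \<and> (x m, x n) \<notin> R" if "m < n" for m n
    using that
  proof (induction n rule: less_Suc_induct)
    case (1 i)
    then show ?case using x by blast
  next
    case (2 i j k)
    then show ?case using \<open>trans R\<close> by (meson transD)
  qed
  have "inj x" by (rule linorder_injI) (metis desc)
  then have d: "inv x (x n) = n" for n by simp
  have "\<not> locally_finite (complex_algebra X R)"
  proof (rule not_locally_finite_if_unbounded_depth[of "range x" _ _ "inv x"])
    fix y z assume yz: "y \<in> range x" "z \<in> range x" "(y, z) \<in> R"
    then obtain m n where "y = x m" "z = x n" by auto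
    then show "inv x z \<le> inv x y" using desc yz d by (metis not_le_imp_less)
  next
    fix y k assume yk: "y \<in> range x" "k < inv x y"
    then show "\<exists>z\<in>range x. (y, z) \<in> R \<and> inv x z = k" using desc d by auto
  qed (use X d in auto)
  then show False using lf by blast
qed

lemma D_free_if_locally_finite:
  assumes "locally_finite (complex_algebra X R)"
  shows "D_free X R"
  unfolding D_free_def
proof (intro notI, elim exE conjE)
  fix Y assume "Y \<subseteq> X"
    and "frames_isomorphic D_carrier D_rel Y (Restr (R \<union> Id_on X) Y)"
  then obtain f where f: "bij_betw f D_carrier Y"
    and iso: "\<forall>p\<in>D_carrier. \<forall>q\<in>D_carrier.
        (p, q) \<in> D_rel \<longleftrightarrow> (f p, f q) \<in> Restr (R \<union> Id_on X) Y"
    unfolding frames_isomorphic_def by (elim exE conjE)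
  note rel = iso[rule_format]
  have fY: "f p \<in> Y" if "p \<in> D_carrier" for p using f that by (auto simp: bij_betw_def)
  \<comment> \<open>The depth of \<open>(n, i)\<close> is the number of points strictly above it in
    its component, so the top has depth 0.\<close>
  define d where "d y = (case inv_into D_carrier f y of (n, i) \<Rightarrow> n - Suc i)" for y
  have d: "d (f (n, i)) = n - Suc i" if "(n, i) \<in> D_carrier" for n i
    by (simp add: d_def bij_betw_inv_into_left[OF f that])
  have repr: "\<exists>n i. (n, i) \<in> D_carrier \<and> i < n \<and> y = f (n, i)" if "y \<in> Y" for y
    using f that by (auto simp: bij_betw_def D_carrier_def)
  have "\<not> locally_finite (complex_algebra X R)"
  proof (rule not_locally_finite_if_unbounded_depth[OF \<open>Y \<subseteq> X\<close>, of _ d])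
    fix y z assume yz: "y \<in> Y" "z \<in> Y" "(y, z) \<in> R"
    obtain n i where y: "(n, i) \<in> D_carrier" "i < n" "y = f (n, i)"
      using repr[OF yz(1)] by blast
    obtain m j where z: "(m, j) \<in> D_carrier" "j < m" "z = f (m, j)"
      using repr[OF yz(2)] by blast
    have "((n, i), (m, j)) \<in> D_rel" using rel[OF y(1) z(1)] y(3) z(3) yz by simp
    then show "d z \<le> d y" using d[OF y(1)] d[OF z(1)] y(3) z(3) by (auto simp: D_rel_def)
  next
    fix y k assume yk: "y \<in> Y" "k < d y"
    obtain n i where y: "(n, i) \<in> D_carrier" "i < n" "y = f (n, i)"
      using repr[OF yk(1)] by blast
    \<comment> \<open>The point of depth \<open>k\<close> in the same component, strictly above
      \<open>(n, i)\<close>.\<close>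
    let ?q = "(n, n - Suc k)"
    have k: "k < n - Suc i" using yk(2) y(3) d[OF y(1)] by simp
    then have q: "?q \<in> D_carrier" "((n, i), ?q) \<in> D_rel" using y
      by (auto simp: D_carrier_def D_rel_def)
    then have "d (f ?q) = k" using d[of n "n - Suc k"] k by simp
    moreover have "(y, f ?q) \<in> R \<union> Id_on X" using rel[OF y(1) q(1)] q(2) y(3) by simp
    \<comment> \<open>The depths \<open>d y\<close> and \<open>k\<close> differ, so the pair does
      not come from the added diagonal.\<close>
    ultimately have "(y, f ?q) \<in> R" using yk by auto
    then show "\<exists>z\<in>Y. (y, z) \<in> R \<and> d z = k" using fY[OF q(1)] \<open>d (f ?q) = k\<close> by blast
  next
    fix k
    have "(Suc k, 0) \<in> D_carrier" by (auto simp: D_carrier_def)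
    then show "\<exists>y\<in>Y. d y = k" using fY d[of "Suc k" 0] by (intro bexI[of _ "f (Suc k, 0)"]) auto
  qed
  then show False using assms by blast
qed

theorem mainTheorem3:
  fixes X :: "'a set" and R :: "'a rel"
  assumes "kripke_frame X R" and "trans R"
  shows "locally_finite (complex_algebra X R) \<longleftrightarrow>
           well_founded_frame X R \<and> D_free X R"
proof (intro iffI conjI; (elim conjE)?)
  assume "well_founded_frame X R" "D_free X R"
  with \<open>trans R\<close> show "locally_finite (complex_algebra X R)"
    by (intro locally_finite_if_tunable tunable_if_well_founded_D_free)
qed (rule well_founded_if_locally_finite[OF \<open>trans R\<close>] D_free_if_locally_finite, assumption)+

end
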